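(* There exist two positive constants $C_3$ and $C_4$ such that, for every integer $n\ge2$ of the form $n=2^{\alpha_1}3^{\alpha_2}\cdots p_k^{\alpha_k}$ with integers $\alpha_1,\alpha_2,\ldots,\alpha_k\ge1$, setting $\underline\alpha=(\alpha_1,\ldots,\alpha_k)$, $$C_3\,\frac{\exp(F(\underline\alpha))}{e^{k}\sqrt{\alpha_1\alpha_2\cdots\alpha_k}}\le K(n)\le C_4\,\frac{\exp(F(\underline\alpha))}{\pi^{k/2}}\le C_4\,\frac{\exp(\rho_k\log n)}{\pi^{k/2}}.$$
   Context: $K$ is the Kalmár function: $K(1)=1$ and, for $n\ge 2$, $K(n)$ is the number of ordered factorizations $n=x_1x_2\cdots x_r$ ($r\ge1$ arbitrary) into integers $x_i\ge 2$. $p_i$ is the $i$-th prime. For $k\ge1$, $\rho_k>0$ is the unique positive real with $\prod_{j=1}^{k}(1-p_j^{-\rho_k})^{-1}=2$. For $\underline x=(x_1,\ldots,x_k)$ with all $x_i>0$, $c(\underline x)$ is the unique $c>0$ with $\prod_{j=1}^{k}(1+x_j/c)=2$, and $F(\underline x)=\sum_{j=1}^{k}x_j\log\left(1+\frac{c(\underline x)}{x_j}\right)$. *)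

theory Defs
  imports Complex_Main "HOL-Library.Infinite_Set" "HOL-Computational_Algebra.Primes"
begin

definition ordered_factorizations :: "nat \<Rightarrow> nat list set" where
  "ordered_factorizations n =
     {xs. xs \<noteq> [] \<and> (\<forall>x\<in>set xs. 2 \<le> x) \<and> prod_list xs = n}"

definition kalmar :: "nat \<Rightarrow> nat" where
  "kalmar n = (if n = 1 then 1 else card (ordered_factorizations n))"

text \<open>Primes are indexed from 1 (\<open>nth_prime 1 = 2\<close>), whereas \<^const>\<open>enumerate\<close> starts at 0.
  The value at 0 is never used.\<close>

definition nth_prime :: "nat \<Rightarrow> nat" where
  "nth_prime i = enumerate {p. prime p} (i - 1)"

definition rho :: "nat \<Rightarrow> real" where
  "rho k = (THE r. 0 < r \<and> (\<Prod>j=1..k. inverse (1 - real (nth_prime j) powr (- r))) = 2)"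

text \<open>A tuple \<open>(x\<^sub>1, \<dots>, x\<^sub>k)\<close> is a function on \<^typ>\<open>nat\<close> of which only the values
  on \<open>{1..k}\<close> are used.\<close>

definition cfun :: "nat \<Rightarrow> (nat \<Rightarrow> real) \<Rightarrow> real" where
  "cfun k x = (THE c. 0 < c \<and> (\<Prod>j=1..k. 1 + x j / c) = 2)"

definition Ffun :: "nat \<Rightarrow> (nat \<Rightarrow> real) \<Rightarrow> real" where
  "Ffun k x = (\<Sum>j=1..k. x j * ln (1 + cfun k x / x j))"

text \<open>The following facts show that the cardinality and the definite descriptions above
  denote what they should.\<close>

lemma finite_ordered_factorizations:
  assumes "n \<noteq> 0"
  shows "finite (ordered_factorizations n)"
proof -
  have len: "length xs \<le> prod_list xs \<and> (\<forall>x\<in>set xs. x \<le> prod_list xs)"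
    if "\<forall>x\<in>set xs. 2 \<le> x" for xs :: "nat list"
    using that
  proof (induction xs)
    case (Cons a xs)
    let ?P = "prod_list xs"
    have IH: "length xs \<le> ?P" "\<forall>x\<in>set xs. x \<le> ?P" and a: "2 \<le> a"
      using Cons by auto
    have "0 \<notin> set xs" using Cons.prems by auto
    hence P: "1 \<le> ?P" by (simp add: Suc_le_eq prod_list_zero_iff zero_less_iff_neq_zero)
    have "2 * ?P \<le> a * ?P" using a by (intro mult_right_mono) auto
    moreover have "a * 1 \<le> a * ?P" using P by (intro mult_left_mono) auto
    ultimately have "Suc (length xs) \<le> a * ?P" "a \<le> a * ?P" "?P \<le> a * ?P"
      using IH(1) P by linarith+
    thus ?case using IH(2) by (auto intro: order_trans)
  qed simp
  have "ordered_factorizations n \<subseteq> {xs. set xs \<subseteq> {..n} \<and> length xs \<le> n}"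
    using len unfolding ordered_factorizations_def by auto
  thus ?thesis
    by (rule finite_subset) (rule finite_lists_length_le, simp)
qed

lemma prime_nth_prime: "prime (nth_prime i)"
  using enumerate_in_set[OF primes_infinite] unfolding nth_prime_def by blast

lemma nth_prime_1: "nth_prime 1 = 2"
  unfolding nth_prime_def
  by (simp add: enumerate_0, rule Least_equality) (auto intro: prime_ge_2_nat)

lemma ex1_level:
  fixes f :: "real \<Rightarrow> real"
  assumes cont: "continuous_on {0<..} f"
    and anti: "\<And>s t. 0 < s \<Longrightarrow> s < t \<Longrightarrow> f t < f s"
    and a: "0 < a" "2 \<le> f a"
    and lim: "(f \<longlongrightarrow> 1) at_top"
  shows "\<exists>!t. 0 < t \<and> f t = 2"
proof -
  have "eventually (\<lambda>t. f t < 2) at_top"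
    using lim by (rule order_tendstoD) simp
  hence "eventually (\<lambda>t. f t < 2 \<and> a \<le> t) at_top"
    using eventually_ge_at_top by (rule eventually_conj)
  then obtain b where b: "f b < 2" "a \<le> b"
    by (auto dest: eventually_happens)
  have "\<exists>t. a \<le> t \<and> t \<le> b \<and> f t = 2"
    using a b by (intro IVT2' continuous_on_subset[OF cont]) auto
  then obtain t where "a \<le> t" "f t = 2" by blast
  hence "0 < t" using a(1) by linarith
  have "s = t" if "0 < s" "f s = 2" for s
    using anti[of s t] anti[of t s] that \<open>0 < t\<close> \<open>f t = 2\<close> by (cases s t rule: linorder_cases) auto
  with \<open>0 < t\<close> \<open>f t = 2\<close> show ?thesis by blast
qed

lemma prod_strict_mono_real:
  fixes f g :: "nat \<Rightarrow> real"
  assumes "1 \<le> k" "\<And>j. j \<in> {1..k} \<Longrightarrow> 0 < f j \<and> f j < g j"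
  shows "prod f {1..k} < prod g {1..k}"
  using assms
  by (intro prod_mono_strict[of 1]) (auto intro: less_imp_le dest: less_trans)

lemma prod_ge_first:
  fixes f :: "nat \<Rightarrow> real"
  assumes "1 \<le> k" "\<And>j. j \<in> {1..k} \<Longrightarrow> 1 \<le> f j" "2 \<le> f 1"
  shows "2 \<le> prod f {1..k}"
proof -
  have "1 \<le> prod f ({1..k} - {1})"
    using assms by (intro prod_ge_1) auto
  hence "2 * 1 \<le> f 1 * prod f ({1..k} - {1})"
    using assms by (intro mult_mono) auto
  thus ?thesis using assms by (subst prod.remove[of _ 1]) auto
qed

lemma ex1_cfun:
  fixes x :: "nat \<Rightarrow> real"
  assumes "1 \<le> k" "\<And>j. j \<in> {1..k} \<Longrightarrow> 0 < x j"
  shows "\<exists>!c. 0 < c \<and> (\<Prod>j=1..k. 1 + x j / c) = (2::real)"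
proof (rule ex1_level)
  show "continuous_on {0<..} (\<lambda>c. \<Prod>j=1..k. 1 + x j / c)"
    by (intro continuous_intros) auto
  show "(\<Prod>j=1..k. 1 + x j / t) < (\<Prod>j=1..k. 1 + x j / s)" if "0 < s" "s < t" for s t
  proof (rule prod_strict_mono_real[OF assms(1)])
    fix j assume "j \<in> {1..k}"
    hence "0 < x j" by (rule assms(2))
    thus "0 < 1 + x j / t \<and> 1 + x j / t < 1 + x j / s"
      using that by (auto intro!: divide_strict_left_mono add_pos_pos)
  qed
  show x1: "0 < x 1" using assms by auto
  show "2 \<le> (\<Prod>j=1..k. 1 + x j / x 1)"
  proof (rule prod_ge_first[OF assms(1)])
    show "1 \<le> 1 + x j / x 1" if "j \<in> {1..k}" for j
      using assms(2)[OF that] x1 by simp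
    show "2 \<le> 1 + x 1 / x 1" using x1 by simp
  qed
  have "((\<lambda>c. \<Prod>j=1..k. 1 + x j / c) \<longlongrightarrow> (\<Prod>j=1..k. 1 + 0)) at_top"
    by (intro tendsto_intros real_tendsto_divide_at_top[OF tendsto_const] filterlim_ident)
  thus "((\<lambda>c. \<Prod>j=1..k. 1 + x j / c) \<longlongrightarrow> 1) at_top" by simp
qed

lemma ex1_rho:
  assumes "1 \<le> k"
  shows "\<exists>!r. 0 < r \<and> (\<Prod>j=1..k. inverse (1 - real (nth_prime j) powr (- r))) = 2"
proof (rule ex1_level)
  have p: "1 < real (nth_prime j)" for j
    using prime_gt_1_nat[OF prime_nth_prime] by simp
  have lt1: "real (nth_prime j) powr (- r) < 1" if "0 < r" for j r
    using powr_less_mono[of "- r" 0 "real (nth_prime j)"] p[of j] that by simp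
  show "continuous_on {0<..} (\<lambda>r. \<Prod>j=1..k. inverse (1 - real (nth_prime j) powr (- r)))"
  proof (intro continuous_intros ballI)
    show "1 - real (nth_prime j) powr (- r) \<noteq> 0" if "r \<in> {0<..}" for j r
      using lt1[of r j] that by auto
    show "real (nth_prime j) \<noteq> 0" for j using p[of j] by linarith
  qed
  show "(\<Prod>j=1..k. inverse (1 - real (nth_prime j) powr (- t)))
      < (\<Prod>j=1..k. inverse (1 - real (nth_prime j) powr (- s)))" if "0 < s" "s < t" for s t
  proof (rule prod_strict_mono_real[OF assms])
    fix j
    have "real (nth_prime j) powr (- t) < real (nth_prime j) powr (- s)"
      using p that by (intro powr_less_mono) auto
    thus "0 < inverse (1 - real (nth_prime j) powr (- t)) \<and>
        inverse (1 - real (nth_prime j) powr (- t)) < inverse (1 - real (nth_prime j) powr (- s))"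
      using lt1[of s j] lt1[of t j] that by (auto intro!: less_imp_inverse_less)
  qed
  show "0 < (1::real)" by simp
  show "2 \<le> (\<Prod>j=1..k. inverse (1 - real (nth_prime j) powr (- 1)))"
  proof (rule prod_ge_first[OF assms])
    show "1 \<le> inverse (1 - real (nth_prime j) powr (- 1))" for j
      using lt1[of 1 j] by (intro one_le_inverse) auto
    show "2 \<le> inverse (1 - real (nth_prime 1) powr (- 1))"
      unfolding nth_prime_1 by (simp add: powr_minus)
  qed
  have "((\<lambda>r. real (nth_prime j) powr (- r)) \<longlongrightarrow> 0) at_top" for j
  proof -
    have "filterlim (\<lambda>r. ln (real (nth_prime j)) * r) at_top at_top"
      using p[of j] by (intro filterlim_tendsto_pos_mult_at_top[OF tendsto_const] filterlim_ident) auto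
    hence "((\<lambda>r. exp (- (ln (real (nth_prime j)) * r))) \<longlongrightarrow> 0) at_top"
      by (intro filterlim_compose[OF exp_at_bot] filterlim_compose[OF filterlim_uminus_at_bot_at_top])
    thus ?thesis using p[of j] by (simp add: powr_def mult.commute)
  qed
  hence "((\<lambda>r. \<Prod>j=1..k. inverse (1 - real (nth_prime j) powr (- r)))
      \<longlongrightarrow> (\<Prod>j=1..k. inverse (1 - 0))) at_top"
    by (intro tendsto_intros) auto
  thus "((\<lambda>r. \<Prod>j=1..k. inverse (1 - real (nth_prime j) powr (- r))) \<longlongrightarrow> 1) at_top" by simp
qed

end

theory Submission
  imports Defs "HOL-Analysis.Infinite_Products"
begin

text \<open>
  The Dirichlet series of \<open>K\<close> is \<open>1 / (2 - \<zeta>(s)) = \<Sum>\<^sub>r \<zeta>(s)\<^sup>r / 2\<^sup>r\<^sup>+\<^sup>1\<close>, so \<open>K(n)\<close> is the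
  sum over \<open>r\<close> of \<open>d\<^sub>r(n) / 2\<^sup>r\<^sup>+\<^sup>1\<close>, where \<open>d\<^sub>r(n)\<close> counts the \<open>r\<close>-tuples of positive
  integers with product \<open>n\<close>. The function \<open>d\<^sub>r\<close> is multiplicative, and its value at a prime
  power with exponent \<open>a\<close> is the binomial coefficient \<open>C(a + r - 1, a)\<close>. Lemma \<open>kalmar_sums\<close>
  proves the expansion without Dirichlet series, from the recurrences that \<open>K\<close> and
  \<open>d\<^sub>r\<close> satisfy over the divisors of \<open>n\<close>.

  By Stirling's formula \<open>C(a + r - 1, a)\<close> has, up to a factor of order \<open>\<surd>a\<close>, the size
  \<open>exp (H(a, r))\<close> with \<open>H(a, b) = a ln (1 + b/a) + b ln (1 + a/b)\<close>. Hence the term of index \<open>r\<close> has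
  the size \<open>exp (G(r))\<close> with \<open>G(t) = \<Sum>\<^sub>j H(\<alpha>\<^sub>j, t) - t ln 2\<close>. The function \<open>G\<close> is concave, its
  derivative is \<open>\<Sum>\<^sub>j ln (1 + \<alpha>\<^sub>j/t) - ln 2\<close>, so it is maximal at \<open>t = c(\<alpha>)\<close>, and the maximum is
  \<open>F(\<alpha>)\<close>.

  Lower bound (\<open>kalmar_lower\<close>): a single term suffices, with \<open>r - 1/2\<close> within distance 1
  of \<open>c\<close>. The shift by one half makes the estimate of the rising factorial exact enough
  to lose nothing but the factor \<open>e \<surd>a\<close> from each \<open>a!\<close>.

  Upper bound (\<open>kalmar_upper\<close>): \<open>G\<close> drops below \<open>F\<close> at linear rate of order \<open>1/\<surd>c\<close> outside a
  window of width \<open>\<surd>c\<close> (\<open>growth_decay\<close>), so the series is of order \<open>\<surd>c\<close> times its largest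
  term, which is at most \<open>exp F / (2\<^sup>k \<surd>(\<Prod>\<alpha>\<^sub>j))\<close> because \<open>a! \<ge> 2 \<surd>a (a/e)\<^sup>a\<close>. As
  \<open>c \<le> 2k \<Prod>\<alpha>\<^sub>j\<close>, what remains is \<open>\<surd>(2k) / 2\<^sup>k\<close>, and this is bounded by a multiple of
  \<open>\<pi>\<^sup>-\<^sup>k\<^sup>/\<^sup>2\<close> because \<open>\<pi> < 4\<close>.

  The comparison of \<open>F(\<alpha>)\<close> with \<open>\<rho>\<^sub>k ln n\<close>, the concavity of \<open>G\<close> and the maximality at \<open>c\<close> all
  come from one inequality, Gibbs' inequality for two-point distributions (\<open>entropy_le\<close>).
\<close>

section \<open>Two-point entropy and Gibbs' inequality\<close>

text \<open>An antiderivative of the logarithm; sums of logarithms are compared with it below.\<close>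

definition xlnx :: "real \<Rightarrow> real" where
  "xlnx x = x * ln x - x"

text \<open>This is \<open>a + b\<close> times the Shannon entropy of the distribution \<open>(a/(a+b), b/(a+b))\<close>.\<close>

definition entropy :: "real \<Rightarrow> real \<Rightarrow> real" where
  "entropy a b = a * ln (1 + b / a) + b * ln (1 + a / b)"

lemma entropy_eq_xlnx:
  assumes "0 < a" "0 < b"
  shows "entropy a b = xlnx (a + b) - xlnx a - xlnx b"
proof -
  have "1 + b / a = (a + b) / a" "1 + a / b = (a + b) / b"
    using assms by (simp_all add: field_simps)
  thus ?thesis
    using assms by (simp add: entropy_def xlnx_def ln_div algebra_simps)
qed

text \<open>Gibbs' inequality: the cross entropy with respect to any other distribution \<open>(p, q)\<close> is
  at least the entropy, since \<open>ln z \<le> z - 1\<close>.\<close>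

lemma entropy_le:
  assumes "0 < a" "0 < b" "0 < p" "0 < q" "p + q = 1"
  shows "entropy a b \<le> - (a * ln p) - b * ln q"
proof -
  have ineq: "d * ln r + d * ln (1 + e / d) \<le> r * (d + e) - d"
    if "0 < d" "0 < e" "0 < r" for d e r :: real
  proof -
    have "ln (r * (1 + e / d)) \<le> r * (1 + e / d) - 1"
      using that by (intro ln_le_minus_one mult_pos_pos add_pos_pos) auto
    hence "d * ln (r * (1 + e / d)) \<le> d * (r * (1 + e / d) - 1)"
      using that by (intro mult_left_mono) auto
    also have "\<dots> = r * (d + e) - d"
      using that by (simp add: field_simps)
    also have "ln (r * (1 + e / d)) = ln r + ln (1 + e / d)"
      using that by (intro ln_mult_pos add_pos_pos) auto
    finally show ?thesis by (simp add: distrib_left)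
  qed
  have "p * (a + b) + q * (b + a) = (p + q) * (a + b)" by (simp add: algebra_simps)
  thus ?thesis
    using ineq[of a b p] ineq[of b a q] assms unfolding entropy_def by simp
qed

text \<open>Concavity of \<open>entropy a\<close>, with the tangent at \<open>y\<close> on the right-hand side. The partial
  derivatives of \<open>entropy\<close> at \<open>(a, y)\<close> are \<open>ln (1 + y/a)\<close> and \<open>ln (1 + a/y)\<close>, and the tangent has no
  constant term because \<open>entropy\<close> is homogeneous of degree 1; it is the cross entropy with
  \<open>p : q = a : y\<close>.\<close>

lemma entropy_tangent:
  assumes "0 < a" "0 < x" "0 < y"
  shows "entropy a x \<le> a * ln (1 + y / a) + x * ln (1 + a / y)"
proof -
  have eq: "1 + y / a = inverse (a / (a + y))" "1 + a / y = inverse (y / (a + y))"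
    using assms by (simp_all add: field_simps)
  have "entropy a x \<le> - (a * ln (a / (a + y))) - x * ln (y / (a + y))"
    using assms by (intro entropy_le) (auto simp: add_divide_distrib[symmetric])
  thus ?thesis
    using assms unfolding eq by (subst (1 2) ln_inverse) auto
qed

section \<open>Factorials and multiset coefficients\<close>

text \<open>The next two estimates bound the integral of \<open>ln\<close> over an interval of length 1 by the
  value at its left endpoint (\<open>ln\<close> increases) and at its midpoint (\<open>ln\<close> is concave).\<close>

lemma ln_le_xlnx_diff:
  assumes "0 < z"
  shows "ln z \<le> xlnx (z + 1) - xlnx z"
proof -
  have "ln (z / (z + 1)) \<le> z / (z + 1) - 1"
    using assms by (intro ln_le_minus_one) auto
  hence "(z + 1) * (ln z - ln (z + 1)) \<le> (z + 1) * (z / (z + 1) - 1)"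
    using assms by (intro mult_left_mono) (auto simp: ln_div)
  also have "\<dots> = -1" using assms by (simp add: field_simps)
  finally show ?thesis by (simp add: xlnx_def algebra_simps)
qed

text \<open>The midpoint rule, rescaled so that the midpoint is 1 and the half-width is \<open>u\<close>.\<close>

lemma xlnx_symmetric_diff_le:
  fixes u :: real
  assumes "0 \<le> u" "u < 1"
  shows "(1 + u) * ln (1 + u) - (1 - u) * ln (1 - u) \<le> 2 * u"
proof -
  define f where "f u = (1 + u) * ln (1 + u) - (1 - u) * ln (1 - u) - 2 * u" for u :: real
  have "f u \<le> f 0"
  proof (rule DERIV_nonpos_imp_nonincreasing[OF assms(1)])
    fix t assume t: "0 \<le> t" "t \<le> u"
    have "(f has_real_derivative (ln (1 + t) + ln (1 - t))) (at t)"
      unfolding f_def using t assms by (auto intro!: derivative_eq_intros)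
    moreover have "ln (1 + t) + ln (1 - t) \<le> 0"
    proof -
      have "ln (1 + t) \<le> t" using t by (intro ln_add_one_self_le_self) auto
      moreover have "ln (1 - t) \<le> (1 - t) - 1" using t assms by (intro ln_le_minus_one) auto
      ultimately show ?thesis by simp
    qed
    ultimately show "\<exists>y. (f has_real_derivative y) (at t) \<and> y \<le> 0" by blast
  qed
  thus ?thesis by (simp add: f_def)
qed

lemma xlnx_diff_le_ln:
  assumes "1/2 < z"
  shows "xlnx (z + 1/2) - xlnx (z - 1/2) \<le> ln z"
proof -
  define u where "u = 1 / (2 * z)"
  have u: "0 < u" "u < 1" using assms by (auto simp: u_def)
  have eq: "z + 1/2 = z * (1 + u)" "z - 1/2 = z * (1 - u)"
    using assms by (auto simp: u_def field_simps)
  have ln_eq: "ln (z * (1 + u)) = ln z + ln (1 + u)" "ln (z * (1 - u)) = ln z + ln (1 - u)"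
    using assms u by (simp_all add: ln_mult_pos)
  have "xlnx (z + 1/2) - xlnx (z - 1/2)
      = z * ((1 + u) * ln (1 + u) - (1 - u) * ln (1 - u)) + 2 * (z * u) * (ln z - 1)"
    unfolding eq xlnx_def ln_eq by (simp add: algebra_simps)
  also have "\<dots> \<le> z * (2 * u) + 2 * (z * u) * (ln z - 1)"
    using xlnx_symmetric_diff_le[of u] u assms by (intro add_mono mult_left_mono) auto
  also have "\<dots> = 2 * (z * u) * ln z" by (simp add: algebra_simps)
  also have "2 * (z * u) = 1" using assms by (simp add: u_def)
  finally show ?thesis by simp
qed

text \<open>With \<open>u = 1 / (2n + 1)\<close> this reads \<open>(n + 1/2) ln (1 + 1/n) \<ge> 1\<close>, which is the induction
  step for the upper Stirling bound.\<close>

lemma ln_ratio_ge: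
  fixes u :: real
  assumes "0 \<le> u" "u < 1"
  shows "2 * u \<le> ln (1 + u) - ln (1 - u)"
proof -
  define f where "f u = ln (1 + u) - ln (1 - u) - 2 * u" for u :: real
  have "f 0 \<le> f u"
  proof (rule DERIV_nonneg_imp_nondecreasing[OF assms(1)])
    fix t assume t: "0 \<le> t" "t \<le> u"
    have "(f has_real_derivative (1 / (1 + t) + 1 / (1 - t) - 2)) (at t)"
      unfolding f_def using t assms by (auto intro!: derivative_eq_intros)
    moreover have "1 - t \<le> 1 / (1 + t)" "1 + t \<le> 1 / (1 - t)"
      using t assms by (simp_all only: pos_le_divide_eq) (simp_all add: pos_le_divide_eq algebra_simps)
    ultimately show "\<exists>y. (f has_real_derivative y) (at t) \<and> 0 \<le> y" by force
  qed
  thus ?thesis by (simp add: f_def)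
qed

lemma ln_fact_le:
  assumes "1 \<le> n"
  shows "ln (fact n) \<le> 1 + ln (real n) / 2 + xlnx (real n)"
  using assms
proof (induction n rule: dec_induct)
  case (step n)
  define u where "u = 1 / (2 * real n + 1)"
  have n: "1 \<le> real n" using step by simp
  have u: "0 < u" "u < 1" using n by (auto simp: u_def)
  have "1 + u = 2 * u * (real n + 1)" "1 - u = 2 * u * real n"
    using n by (simp_all add: u_def field_simps)
  hence "2 * u \<le> ln (real n + 1) - ln (real n)"
    using ln_ratio_ge[of u] u n by (simp add: ln_mult_pos)
  hence "(real n + 1/2) * (2 * u) \<le> (real n + 1/2) * (ln (real n + 1) - ln (real n))"
    by (intro mult_left_mono) auto
  also have "(real n + 1/2) * (2 * u) = 1" using n by (simp add: u_def field_simps)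
  finally have key: "1 \<le> (real n + 1/2) * (ln (real n + 1) - ln (real n))" .
  have "ln (fact (Suc n)) = ln (real n + 1) + ln (fact n :: real)"
    by (simp add: ln_mult_pos add.commute)
  thus ?case
    using step.IH key by (simp add: xlnx_def algebra_simps)
qed (simp add: xlnx_def)

text \<open>The best constant is \<open>\<surd>(2\<pi>)\<close> in place of \<open>2\<close>. All that matters later is that its square 4
  exceeds \<open>\<pi>\<close>. The midpoint rule applied to the factors \<open>2, \<dots>, n\<close> gives the constant
  \<open>(2e/3)\<^sup>3\<^sup>/\<^sup>2 \<ge> 2\<close>.\<close>

lemma ln_fact_ge:
  assumes "1 \<le> n"
  shows "ln 2 + ln (real n) / 2 + xlnx (real n) \<le> ln (fact n)"
proof -
  have n: "1 \<le> real n" using assms by simp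
  have "xlnx (real n + 1/2) - xlnx (3/2) \<le> ln (fact n)"
    using assms
  proof (induction n rule: dec_induct)
    case (step n)
    have "ln (fact (Suc n)) = ln (real n + 1) + ln (fact n :: real)"
      by (simp add: ln_mult_pos add.commute)
    thus ?case
      using step.IH xlnx_diff_le_ln[of "real n + 1"] step.hyps by (simp add: add.commute)
  qed simp
  moreover have "ln 2 \<le> - xlnx (3/2)"
  proof -
    have "ln (5/2) \<le> (1::real)"
      using exp_lower_Taylor_quadratic[of 1] ln_mono[of "5/2" "exp (1::real)"] by simp
    moreover have "ln (5/2) - ln (3/2) = ln (5/3 :: real)"
      by (simp flip: ln_divide_pos)
    moreover have "2 * ln 2 \<le> 3 * ln (5/3 :: real)"
      using ln_mono[of "2^2" "(5/3)^3 :: real"] by (simp only: ln_realpow) (simp add: power_divide)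
    ultimately show ?thesis unfolding xlnx_def by (simp add: field_simps)
  qed
  moreover have "xlnx (real n) + ln (real n) / 2 \<le> xlnx (real n + 1/2)"
  proof -
    have "ln (real n / (real n + 1/2)) \<le> real n / (real n + 1/2) - 1"
      using n by (intro ln_le_minus_one) auto
    hence "(real n + 1/2) * (ln (real n) - ln (real n + 1/2))
        \<le> (real n + 1/2) * (real n / (real n + 1/2) - 1)"
      using n by (intro mult_left_mono) (auto simp: ln_div)
    also have "\<dots> = -1/2" using n by (simp add: field_simps)
    finally show ?thesis by (simp add: xlnx_def algebra_simps)
  qed
  ultimately show ?thesis by linarith
qed

text \<open>The number of multisets of size \<open>a\<close> over \<open>r\<close> letters, \<open>C(a + r - 1, a)\<close>. The rising
  factorial covers \<open>r = 0\<close> without truncated subtraction.\<close>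

definition multichoose :: "nat \<Rightarrow> nat \<Rightarrow> real" where
  "multichoose r a = pochhammer (real r) a / fact a"

lemma pochhammer_le_xlnx:
  assumes "0 < r"
  shows "pochhammer r a \<le> exp (xlnx (r + real a) - xlnx r)"
proof (induction a)
  case (Suc a)
  have "pochhammer r (Suc a) = pochhammer r a * (r + real a)"
    by (simp add: pochhammer_Suc)
  also have "\<dots> \<le> exp (xlnx (r + real a) - xlnx r) * (r + real a)"
    using assms Suc by (intro mult_right_mono) auto
  also have "r + real a = exp (ln (r + real a))" using assms by (simp add: exp_ln)
  also have "exp (xlnx \<dots> - xlnx r) * exp (ln (r + real a))
      \<le> exp (xlnx (r + real (Suc a)) - xlnx r)"
    using ln_le_xlnx_diff[of "r + real a"] assms
    by (simp only: exp_add[symmetric] exp_le_cancel_iff) (simp add: add_ac)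
  finally show ?case .
qed simp

text \<open>The midpoint rule for the factors \<open>x + 1/2 + i\<close> integrates over an interval that starts
  exactly at \<open>x\<close>, so that no error term appears.\<close>

lemma pochhammer_ge_xlnx:
  assumes "0 < x"
  shows "exp (xlnx (x + real a) - xlnx x) \<le> pochhammer (x + 1/2) a"
proof (induction a)
  case (Suc a)
  have "exp (xlnx (x + real (Suc a)) - xlnx x)
      \<le> exp (xlnx (x + real a) - xlnx x) * exp (ln (x + 1/2 + real a))"
    using xlnx_diff_le_ln[of "x + 1/2 + real a"] assms
    by (simp only: exp_add[symmetric] exp_le_cancel_iff) (simp add: add_ac)
  also have "exp (ln (x + 1/2 + real a)) = x + 1/2 + real a" using assms by (intro exp_ln) auto
  also have "exp (xlnx (x + real a) - xlnx x) * (x + 1/2 + real a)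
      \<le> pochhammer (x + 1/2) a * (x + 1/2 + real a)"
    using assms Suc by (intro mult_right_mono) auto
  finally show ?case by (simp add: pochhammer_Suc)
qed simp

lemma multichoose_upper:
  assumes "1 \<le> r" "1 \<le> a"
  shows "multichoose r a \<le> exp (entropy a r) / (2 * sqrt a)"
proof -
  have "2 * sqrt a * exp (xlnx a) = exp (ln 2 + ln (real a) / 2 + xlnx (real a))"
    using assms by (simp add: exp_add flip: ln_sqrt)
  also have "\<dots> \<le> exp (ln (fact a))"
    using ln_fact_ge[OF assms(2)] by (simp only: exp_le_cancel_iff)
  also have "\<dots> = (fact a :: real)" by simp
  finally have fact: "2 * sqrt a * exp (xlnx a) \<le> fact a" .
  have "multichoose r a \<le> exp (xlnx (real r + real a) - xlnx r) / (2 * sqrt a * exp (xlnx a))"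
    unfolding multichoose_def
    using fact pochhammer_le_xlnx[of "real r" a] assms by (intro frac_le) auto
  also have "\<dots> = exp (entropy a r) / (2 * sqrt a)"
    using assms by (simp add: entropy_eq_xlnx exp_diff add.commute)
  finally show ?thesis .
qed

lemma multichoose_lower:
  assumes "1 \<le> r" "1 \<le> a"
  shows "exp (entropy a (real r - 1/2)) / (exp 1 * sqrt a) \<le> multichoose r a"
proof -
  have "(fact a :: real) = exp (ln (fact a))" by simp
  also have "\<dots> \<le> exp (1 + ln (real a) / 2 + xlnx (real a))"
    using ln_fact_le[OF assms(2)] by (simp only: exp_le_cancel_iff)
  also have "\<dots> = exp 1 * sqrt a * exp (xlnx a)"
    using assms by (simp add: exp_add flip: ln_sqrt)
  finally have fact: "fact a \<le> exp 1 * sqrt a * exp (xlnx a)" .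
  have "exp (entropy a (real r - 1/2)) / (exp 1 * sqrt a)
      = exp (xlnx (real r - 1/2 + real a) - xlnx (real r - 1/2)) / (exp 1 * sqrt a * exp (xlnx a))"
    using assms by (simp add: entropy_eq_xlnx exp_diff add.commute)
  also have "\<dots> \<le> multichoose r a"
    unfolding multichoose_def
    using fact pochhammer_ge_xlnx[of "real r - 1/2" a] assms by (intro frac_le pochhammer_nonneg) auto
  finally show ?thesis .
qed


section \<open>The Kalmar function as a series of tuple counts\<close>

text \<open>Admitting the empty list makes the value at \<open>1\<close> equal to 1, in agreement with the
  convention for \<^const>\<open>kalmar\<close>, and makes the recurrence over divisors uniform.\<close>

definition factor_lists :: "nat \<Rightarrow> nat list set" where
  "factor_lists n = {xs. (\<forall>x\<in>set xs. 2 \<le> x) \<and> prod_list xs = n}"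

lemma factor_lists_1: "factor_lists 1 = {[]}"
proof -
  have "xs = []" if "\<forall>x\<in>set xs. 2 \<le> x" "prod_list xs = 1" for xs :: "nat list"
    using that by (cases xs) auto
  thus ?thesis by (auto simp: factor_lists_def)
qed

lemma factor_lists_eq_ordered:
  assumes "n \<noteq> 1"
  shows "factor_lists n = ordered_factorizations n"
  using assms by (auto simp: factor_lists_def ordered_factorizations_def)

lemma kalmar_eq_card: "kalmar n = card (factor_lists n)"
  by (cases "n = 1") (simp_all add: kalmar_def factor_lists_1 [simplified] factor_lists_eq_ordered)

lemma finite_factor_lists: "n \<noteq> 0 \<Longrightarrow> finite (factor_lists n)"
  using finite_ordered_factorizations[of n] factor_lists_eq_ordered[of n] factor_lists_1
  by (cases "n = 1") auto

text \<open>Removing the first factor \<open>n div d\<close> leaves a factorization of a proper divisor \<open>d\<close>.\<close>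

lemma kalmar_rec:
  assumes "2 \<le> n"
  shows "kalmar n = (\<Sum>d | d dvd n \<and> d < n. kalmar d)"
proof -
  let ?D = "{d. d dvd n \<and> d < n}"
  have fin: "finite ?D" by simp
  have pos: "d \<noteq> 0" if "d \<in> ?D" for d using that by (auto intro: Nat.gr0I)
  have "factor_lists n = (\<Union>d\<in>?D. (#) (n div d) ` factor_lists d)"
  proof (intro equalityI subsetI)
    fix xs assume xs: "xs \<in> factor_lists n"
    then obtain x ys where xs_eq: "xs = x # ys"
      using assms by (cases xs) (auto simp: factor_lists_def)
    have "n = x * prod_list ys" "2 \<le> x" "ys \<in> factor_lists (prod_list ys)"
      using xs by (auto simp: factor_lists_def xs_eq)
    moreover from this have "prod_list ys \<noteq> 0" using assms by (intro notI) simp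
    ultimately show "xs \<in> (\<Union>d\<in>?D. (#) (n div d) ` factor_lists d)"
      unfolding xs_eq by (intro UN_I[of "prod_list ys"]) auto
  next
    fix xs assume "xs \<in> (\<Union>d\<in>?D. (#) (n div d) ` factor_lists d)"
    then obtain d ys where d: "d dvd n" "d < n" "ys \<in> factor_lists d" "xs = (n div d) # ys"
      by auto
    have "n div d * d = n" using d by simp
    moreover have "2 \<le> n div d"
    proof (rule ccontr)
      assume "\<not> 2 \<le> n div d"
      hence "n div d = 0 \<or> n div d = 1" by linarith
      thus False using \<open>n div d * d = n\<close> d assms by auto
    qed
    ultimately show "xs \<in> factor_lists n" using d by (auto simp: factor_lists_def)
  qed
  also have "card \<dots> = (\<Sum>d\<in>?D. card ((#) (n div d) ` factor_lists d))"
  proof (intro card_UN_disjoint fin ballI impI finite_imageI finite_factor_lists)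
    fix d e assume "d \<in> ?D" "e \<in> ?D" "d \<noteq> e"
    thus "(#) (n div d) ` factor_lists d \<inter> (#) (n div e) ` factor_lists e = {}"
      by (auto simp: factor_lists_def)
  qed (use pos in auto)
  also have "\<dots> = (\<Sum>d\<in>?D. kalmar d)"
    by (intro sum.cong refl) (simp add: card_image kalmar_eq_card)
  finally show ?thesis by (simp add: kalmar_eq_card)
qed

lemma multichoose_0_right [simp]: "multichoose r 0 = 1"
  by (simp add: multichoose_def)

lemma multichoose_nonneg: "0 \<le> multichoose r a"
  by (simp add: multichoose_def pochhammer_of_nat)

lemma multichoose_sum: "(\<Sum>b\<le>a. multichoose r b) = multichoose (Suc r) a"
proof (induction a)
  case (Suc a)
  have "multichoose (Suc r) a + multichoose r (Suc a) = multichoose (Suc r) (Suc a)"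
    unfolding multichoose_def pochhammer_rec[of "real r"] pochhammer_Suc[of "real (Suc r)"]
    by (simp add: divide_simps) (simp add: algebra_simps)
  thus ?case using Suc by simp
qed simp

text \<open>The number \<open>d\<^sub>r(n)\<close> of \<open>r\<close>-tuples of positive integers with product \<open>n\<close>: for each prime, its
  multiplicity in \<open>n\<close> is distributed over the \<open>r\<close> positions.\<close>

definition tuple_count :: "nat \<Rightarrow> nat \<Rightarrow> real" where
  "tuple_count r n = (\<Prod>p\<in>prime_factors n. multichoose r (multiplicity p n))"

lemma tuple_count_nonneg: "0 \<le> tuple_count r n"
  unfolding tuple_count_def by (intro prod_nonneg multichoose_nonneg)

lemma tuple_count_1 [simp]: "tuple_count r (Suc 0) = 1"
  by (simp add: tuple_count_def)

lemma tuple_count_mult: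
  assumes "coprime a b" "a \<noteq> 0" "b \<noteq> 0"
  shows "tuple_count r (a * b) = tuple_count r a * tuple_count r b"
proof -
  have disj: "prime_factors a \<inter> prime_factors b = {}"
    using assms(1) by (auto simp: in_prime_factors_iff dest: coprime_common_divisor)
  have other: "multiplicity p d = 0" if "prime p" "p \<notin> prime_factors d" "d \<noteq> 0" for p d :: nat
    using that by (auto simp: in_prime_factors_iff intro: not_dvd_imp_multiplicity_0)
  have "multiplicity p (a * b) = multiplicity p a" if "p \<in> prime_factors a" for p
    using that disj assms other[of p b]
    by (subst prime_elem_multiplicity_mult_distrib) auto
  moreover have "multiplicity p (a * b) = multiplicity p b" if "p \<in> prime_factors b" for p
    using that disj assms other[of p a]
    by (subst prime_elem_multiplicity_mult_distrib) auto
  ultimately show ?thesis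
    unfolding tuple_count_def prime_factors_product[OF assms(2,3)]
    using disj by (subst prod.union_disjoint) auto
qed

lemma tuple_count_prime_power:
  assumes "prime p"
  shows "tuple_count r (p ^ a) = multichoose r a"
  using assms
  by (cases "a = 0") (auto simp: tuple_count_def prime_factorization_prime_power)

lemma sum_divisors_coprime:
  fixes f :: "nat \<Rightarrow> real"
  assumes "coprime a b" 
  shows "(\<Sum>d | d dvd a * b. f d) = (\<Sum>x | x dvd a. \<Sum>y | y dvd b. f (x * y))"
proof -
  have gcds: "gcd (x * y) a = x" "gcd (x * y) b = y" if "x dvd a" "y dvd b" for x y
  proof -
    have "coprime a y" "coprime b x"
      using assms that by (meson coprime_divisors dvd_refl coprime_commute)+
    thus "gcd (x * y) a = x" "gcd (x * y) b = y"
      using that by (simp_all add: gcd_mult_left_right_cancel gcd_mult_left_left_cancel gcd_nat.absorb1)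
  qed
  have "gcd d a * gcd d b = d" if dvd: "d dvd a * b" for d
  proof -
    obtain x y where "d = x * y" "x dvd a" "y dvd b"
      using division_decomp[OF dvd] by auto
    thus ?thesis by (simp add: gcds)
  qed
  hence "(\<Sum>d | d dvd a * b. f d) = (\<Sum>(x, y)\<in>{x. x dvd a} \<times> {y. y dvd b}. f (x * y))"
    by (intro sum.reindex_bij_witness[of _ "\<lambda>(x, y). x * y" "\<lambda>d. (gcd d a, gcd d b)"])
       (auto simp: gcds mult_dvd_mono)
  thus ?thesis by (simp add: sum.cartesian_product)
qed

text \<open>The recurrence for \<open>d\<^sub>r\<close> (split off one entry of the tuple). Both sides are multiplicative,
  and at a prime power it is the parallel summation of binomial coefficients.\<close>

lemma sum_tuple_count:
  assumes "0 < n"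
  shows "(\<Sum>d | d dvd n. tuple_count r d) = tuple_count (Suc r) n"
  using assms
proof (induction n rule: less_induct)
  case (less n)
  show ?case
  proof (cases "n = 1")
    case False
    then obtain p where p: "prime p" "p dvd n" using prime_factor_nat by blast
    define a where "a = multiplicity p n"
    have "n \<noteq> 0" "\<not> is_unit p" using less.prems p by auto
    then obtain m where m: "n = p ^ a * m" "\<not> p dvd m"
      unfolding a_def by (rule multiplicity_decompose')
    have m0: "0 < m" using m less.prems by (intro Nat.gr0I) auto
    have "a \<noteq> 0" using m p by (intro notI) auto
    hence "1 < p ^ a" using prime_gt_1_nat[OF p(1)] by (intro one_less_power) auto
    hence "m < n" using m0 m(1) by simp
    have cop: "coprime (p ^ a) m"
      using p m by (simp add: prime_imp_coprime)
    have "(\<Sum>d | d dvd n. tuple_count r d)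
        = (\<Sum>x | x dvd p ^ a. \<Sum>y | y dvd m. tuple_count r x * tuple_count r y)"
      unfolding m(1) sum_divisors_coprime[OF cop]
      using p m0
      by (intro sum.cong refl tuple_count_mult coprime_divisors[OF _ _ cop])
         (auto intro!: Nat.gr0I simp: prime_gt_0_nat)
    also have "\<dots> = (\<Sum>x | x dvd p ^ a. tuple_count r x) * tuple_count (Suc r) m"
      using less.IH[OF \<open>m < n\<close> m0] by (simp add: sum_product sum_distrib_left sum_distrib_right flip: sum_product)
    also have "(\<Sum>x | x dvd p ^ a. tuple_count r x) = (\<Sum>b\<le>a. tuple_count r (p ^ b))"
    proof -
      have "{x. x dvd p ^ a} = (^) p ` {..a}"
        using p by (auto simp: divides_primepow_nat)
      moreover have "inj_on ((^) p) {..a}"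
        using prime_gt_1_nat[OF p(1)] by (auto simp: inj_on_def)
      ultimately show ?thesis by (simp add: sum.reindex)
    qed
    also have "\<dots> = tuple_count (Suc r) (p ^ a)"
      using p by (simp add: tuple_count_prime_power multichoose_sum)
    also have "\<dots> * tuple_count (Suc r) m = tuple_count (Suc r) n"
      unfolding m(1) using cop p m0 by (subst tuple_count_mult) auto
    finally show ?thesis .
  qed simp
qed

lemma tuple_count_0:
  assumes "2 \<le> n"
  shows "tuple_count 0 n = 0"
proof -
  obtain p where p: "prime p" "p dvd n" using prime_factor_nat[of n] assms by auto
  hence "p \<in> prime_factors n" using assms by (auto simp: in_prime_factors_iff)
  moreover have "multiplicity p n \<noteq> 0" 
    using p assms by (subst prime_elem_multiplicity_eq_zero_iff) auto
  hence "multichoose 0 (multiplicity p n) = 0" by (simp add: multichoose_def pochhammer_0_left)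
  ultimately show ?thesis unfolding tuple_count_def by (intro prod_zero) auto
qed

text \<open>Write \<open>T\<^sub>r\<close> for the terms at \<open>n\<close>. Splitting \<open>d = n\<close> off the recurrence for \<open>d\<^sub>r\<close> gives
  \<open>T\<^sub>r\<^sub>+\<^sub>1 = (T\<^sub>r + U\<^sub>r) / 2\<close>, where \<open>U\<^sub>r\<close> collects the proper divisors; by induction \<open>\<Sum> U\<^sub>r\<close> is
  \<open>\<Sum> K(d) = K(n)\<close>. As \<open>T\<^sub>0 = 0\<close>, the partial sums of \<open>T\<close> are bounded by those of \<open>U\<close>,
  and the limit \<open>P\<close> satisfies \<open>P = (P + K(n)) / 2\<close>.\<close>

lemma kalmar_sums:
  assumes "0 < n"
  shows "(\<lambda>r. tuple_count r n / 2 ^ Suc r) sums real (kalmar n)"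
  using assms
proof (induction n rule: less_induct)
  case (less n)
  show ?case
  proof (cases "n = 1")
    case True
    have "(\<lambda>r. (1/2) ^ r * (1/2)) sums (1 / (1 - 1/2) * (1/2 :: real))"
      by (intro sums_mult2 geometric_sums) simp
    thus ?thesis using True by (simp add: kalmar_def power_divide mult.commute)
  next
    case False
    hence n: "2 \<le> n" using less.prems by simp
    let ?D = "{d. d dvd n \<and> d < n}"
    define T where "T r = tuple_count r n / 2 ^ Suc r" for r
    define U where "U r = (\<Sum>d\<in>?D. tuple_count r d / 2 ^ Suc r)" for r
    have T_nonneg: "0 \<le> T r" for r by (simp add: T_def tuple_count_nonneg)
    have U_nonneg: "0 \<le> U r" for r unfolding U_def by (intro sum_nonneg) (simp add: tuple_count_nonneg)
    have "U sums (\<Sum>d\<in>?D. real (kalmar d))"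
      unfolding U_def using n by (intro sums_sum less.IH) (auto intro: Nat.gr0I)
    hence U: "U sums real (kalmar n)" by (subst kalmar_rec[OF n]) simp
    have T_Suc: "T (Suc r) = (T r + U r) / 2" for r
    proof -
      have "{d. d dvd n} = insert n ?D" using n by (auto dest: dvd_imp_le)
      hence "tuple_count (Suc r) n = tuple_count r n + (\<Sum>d\<in>?D. tuple_count r d)"
        using sum_tuple_count[OF less.prems, of r] by simp
      thus ?thesis unfolding T_def U_def by (simp add: field_simps flip: sum_divide_distrib)
    qed
    have "T 0 = 0" using n by (simp add: T_def tuple_count_0)
    hence partial: "sum T {..<Suc N} = (sum T {..<N} + sum U {..<N}) / 2" for N
      by (subst sum.lessThan_Suc_shift) (simp add: T_Suc sum.distrib flip: sum_divide_distrib)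
    have "sum T {..<N} \<le> real (kalmar n)" for N
    proof -
      have "sum T {..<N} + T N = (sum T {..<N} + sum U {..<N}) / 2"
        using partial[of N] by simp
      hence "sum T {..<N} \<le> sum U {..<N}"
        using T_nonneg[of N] by (simp add: field_simps)
      moreover have "sum U {..<N} \<le> real (kalmar n)"
        using sum_le_suminf[of U "{..<N}"] U U_nonneg by (simp add: sums_iff)
      ultimately show ?thesis by linarith
    qed
    hence "summable T"
      using T_nonneg by (intro bounded_imp_summable[of _ "real (kalmar n)"]) (simp_all flip: lessThan_Suc_atMost del: sum.lessThan_Suc)
    then obtain P where P: "T sums P" by (auto simp: summable_def)
    have "(\<lambda>N. (sum T {..<N} + sum U {..<N}) / 2) \<longlonglongrightarrow> (P + real (kalmar n)) / 2"
      using P U unfolding sums_def by (intro tendsto_intros) auto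
    moreover have "(\<lambda>N. (sum T {..<N} + sum U {..<N}) / 2) \<longlonglongrightarrow> P"
      using P unfolding sums_def partial[symmetric] by (rule LIMSEQ_Suc)
    ultimately have "(P + real (kalmar n)) / 2 = P" by (rule LIMSEQ_unique)
    thus ?thesis using P unfolding T_def by simp
  qed
qed

lemma inj_on_nth_prime: "inj_on nth_prime {1..}"
proof (rule inj_onI)
  fix i j assume "i \<in> {1..}" "j \<in> {1..}" "nth_prime i = nth_prime j"
  thus "i = j"
    using inj_enumerate[OF primes_infinite] unfolding nth_prime_def inj_def by fastforce
qed

lemma tuple_count_prod_primes:
  "tuple_count r (\<Prod>i=1..k. nth_prime i ^ \<alpha> i) = (\<Prod>i=1..k. multichoose r (\<alpha> i))"
proof (induction k)
  case (Suc k)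
  have "coprime (nth_prime i) (nth_prime (Suc k))" if "i \<in> {1..k}" for i
  proof (rule primes_coprime[OF prime_nth_prime prime_nth_prime])
    show "nth_prime i \<noteq> nth_prime (Suc k)"
      using inj_onD[OF inj_on_nth_prime, of i "Suc k"] that by auto
  qed
  hence "coprime (\<Prod>i=1..k. nth_prime i ^ \<alpha> i) (nth_prime (Suc k) ^ \<alpha> (Suc k))"
    by (intro prod_coprime_left) auto
  thus ?case
    using Suc prime_nth_prime prime_gt_0_nat[OF prime_nth_prime]
    by (simp add: tuple_count_mult tuple_count_prime_power)
qed simp


section \<open>The exponent of the terms and its maximum\<close>

definition growth :: "nat \<Rightarrow> (nat \<Rightarrow> real) \<Rightarrow> real \<Rightarrow> real" where
  "growth k x t = (\<Sum>j=1..k. entropy (x j) t) - t * ln 2"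

text \<open>The derivative of \<open>growth k x\<close> at \<open>t\<close>.\<close>

definition slope :: "nat \<Rightarrow> (nat \<Rightarrow> real) \<Rightarrow> real \<Rightarrow> real" where
  "slope k x t = (\<Sum>j=1..k. ln (1 + x j / t)) - ln 2"

lemma ln_diff_le:
  fixes u v :: real
  assumes "0 < u" "0 < v"
  shows "ln u - ln v \<le> u / v - 1"
  using ln_le_minus_one[of "u / v"] assms by (simp add: ln_div)

context
  fixes k :: nat and x :: "nat \<Rightarrow> real"
  assumes k: "1 \<le> k" and x_pos: "\<And>j. j \<in> {1..k} \<Longrightarrow> 0 < x j"
begin

lemma growth_tangent:
  assumes "0 < t" "0 < y"
  shows "growth k x t \<le> growth k x y + (t - y) * slope k x y"
proof -
  have "(\<Sum>j=1..k. entropy (x j) t) \<le> (\<Sum>j=1..k. x j * ln (1 + y / x j) + t * ln (1 + x j / y))"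
    using assms x_pos by (intro sum_mono entropy_tangent) auto
  also have "\<dots> = (\<Sum>j=1..k. x j * ln (1 + y / x j)) + t * (\<Sum>j=1..k. ln (1 + x j / y))"
    by (simp add: sum.distrib sum_distrib_left)
  moreover have "growth k x y
      = (\<Sum>j=1..k. x j * ln (1 + y / x j)) + y * (\<Sum>j=1..k. ln (1 + x j / y)) - y * ln 2"
    by (simp add: growth_def entropy_def sum.distrib sum_distrib_left)
  ultimately show ?thesis
    by (simp add: growth_def[of _ _ t] slope_def algebra_simps)
qed

lemma cfun_pos: "0 < cfun k x"
  and cfun_prod: "(\<Prod>j=1..k. 1 + x j / cfun k x) = 2"
  using theI'[OF ex1_cfun[OF k x_pos]] by (auto simp: cfun_def)

lemma one_plus_cfun_pos: "j \<in> {1..k} \<Longrightarrow> 0 < 1 + x j / cfun k x"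
  using x_pos cfun_pos by (auto intro!: add_pos_pos)

lemma slope_cfun: "slope k x (cfun k x) = 0"
proof -
  have "ln (\<Prod>j=1..k. 1 + x j / cfun k x) = (\<Sum>j=1..k. ln (1 + x j / cfun k x))"
    using one_plus_cfun_pos by (intro ln_prod) force+
  thus ?thesis unfolding cfun_prod by (simp add: slope_def)
qed

lemma growth_cfun: "growth k x (cfun k x) = Ffun k x"
proof -
  have "growth k x (cfun k x) = Ffun k x + cfun k x * slope k x (cfun k x)"
    by (simp add: growth_def Ffun_def slope_def entropy_def sum.distrib sum_distrib_left
        algebra_simps)
  thus ?thesis by (simp add: slope_cfun)
qed

lemma growth_le_Ffun: "0 < t \<Longrightarrow> growth k x t \<le> Ffun k x"
  using growth_tangent[OF _ cfun_pos] by (simp add: growth_cfun slope_cfun)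

text \<open>Weierstrass' product inequality: the numbers \<open>1 - x\<^sub>j / (x\<^sub>j + c) = 1 / (1 + x\<^sub>j / c)\<close> have
  product \<open>1/2\<close>. This makes the curvature of \<open>growth\<close> at \<open>c\<close> at least of order \<open>1/c\<close>, however many
  \<open>x\<^sub>j\<close> there are.\<close>

lemma cfun_weights: "1/2 \<le> (\<Sum>j=1..k. x j / (x j + cfun k x))"
proof -
  have "1 - (\<Sum>j=1..k. x j / (x j + cfun k x)) \<le> (\<Prod>j=1..k. 1 - x j / (x j + cfun k x))"
    using x_pos cfun_pos
    by (intro Weierstrass_prod_ineq) (auto simp: divide_le_eq_1 add_pos_pos less_imp_le)
  also have "\<dots> = (\<Prod>j=1..k. inverse (1 + x j / cfun k x))"
  proof (intro prod.cong refl)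
    fix j assume "j \<in> {1..k}"
    thus "1 - x j / (x j + cfun k x) = inverse (1 + x j / cfun k x)"
      using x_pos[of j] cfun_pos by (simp add: divide_simps add_pos_pos)
  qed
  also have "\<dots> = inverse (\<Prod>j=1..k. 1 + x j / cfun k x)"
    using prod_inversef[of "\<lambda>j. 1 + x j / cfun k x" "{1..k}"] by (simp add: o_def)
  also have "\<dots> = 1/2" unfolding cfun_prod by simp
  finally show ?thesis by simp
qed

lemma cfun_ge_first: "x 1 \<le> cfun k x"
proof -
  have "1 \<le> (\<Prod>j\<in>{1..k} - {1}. 1 + x j / cfun k x)"
    using x_pos cfun_pos by (intro prod_ge_1) (auto intro!: divide_nonneg_pos less_imp_le)
  hence "(1 + x 1 / cfun k x) * 1 \<le> (1 + x 1 / cfun k x) * (\<Prod>j\<in>{1..k} - {1}. 1 + x j / cfun k x)"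
    using one_plus_cfun_pos[of 1] k by (intro mult_left_mono) auto
  also have "\<dots> = 2"
    using k by (subst cfun_prod[symmetric], subst prod.remove[of _ 1]) auto
  finally show ?thesis using cfun_pos by simp
qed

lemma cfun_le_sum: "cfun k x \<le> 2 * (\<Sum>j=1..k. x j)"
proof -
  have "1/2 \<le> (\<Sum>j=1..k. x j / (x j + cfun k x))" by (rule cfun_weights)
  also have "\<dots> \<le> (\<Sum>j=1..k. x j / cfun k x)"
    using x_pos cfun_pos by (intro sum_mono divide_left_mono) (auto intro!: mult_pos_pos add_pos_pos less_imp_le)
  also have "\<dots> = (\<Sum>j=1..k. x j) / cfun k x" by (simp add: sum_divide_distrib)
  finally show ?thesis using cfun_pos by (simp add: field_simps)
qed

lemma slope_eq: "slope k x y = (\<Sum>j=1..k. ln (1 + x j / y) - ln (1 + x j / cfun k x))"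
  using slope_cfun by (simp add: slope_def sum_subtractf)

lemma slope_right:
  assumes "cfun k x \<le> y"
  shows "slope k x y \<le> - ((y - cfun k x) / (2 * y))"
proof -
  have y: "0 < y" using cfun_pos assms by linarith
  have "slope k x y \<le> (\<Sum>j=1..k. - ((y - cfun k x) / y) * (x j / (x j + cfun k x)))"
    unfolding slope_eq
  proof (rule sum_mono)
    fix j assume j: "j \<in> {1..k}"
    have "0 < x j" using x_pos j .
    hence "ln (1 + x j / y) - ln (1 + x j / cfun k x) \<le> (1 + x j / y) / (1 + x j / cfun k x) - 1"
      using y cfun_pos by (intro ln_diff_le add_pos_pos) auto
    also have "\<dots> = - ((y - cfun k x) / y) * (x j / (x j + cfun k x))"
      using y cfun_pos \<open>0 < x j\<close> add_pos_pos[OF \<open>0 < x j\<close> cfun_pos]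
      by (simp add: divide_simps) (simp add: algebra_simps)
    finally show "ln (1 + x j / y) - ln (1 + x j / cfun k x)
      \<le> - ((y - cfun k x) / y) * (x j / (x j + cfun k x))" .
  qed
  also have "\<dots> = - ((y - cfun k x) / y) * (\<Sum>j=1..k. x j / (x j + cfun k x))"
    by (simp add: sum_distrib_left)
  also have "\<dots> \<le> - ((y - cfun k x) / y) * (1/2)"
    using cfun_weights assms y by (intro mult_left_mono_neg) auto
  finally show ?thesis by simp
qed

lemma slope_left:
  assumes "0 < y" "y \<le> cfun k x"
  shows "(cfun k x - y) / (2 * cfun k x) \<le> slope k x y"
proof -
  let ?c = "cfun k x"
  have "(?c - y) / (2 * ?c) = ((?c - y) / ?c) * (1/2)" by simp
  also have "\<dots> \<le> ((?c - y) / ?c) * (\<Sum>j=1..k. x j / (x j + ?c))"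
    using cfun_weights assms cfun_pos by (intro mult_left_mono) auto
  also have "\<dots> = (\<Sum>j=1..k. ((?c - y) / ?c) * (x j / (x j + ?c)))"
    by (simp add: sum_distrib_left)
  also have "\<dots> \<le> slope k x y"
    unfolding slope_eq
  proof (rule sum_mono)
    fix j assume j: "j \<in> {1..k}"
    have xj: "0 < x j" using x_pos j .
    have "((?c - y) / ?c) * (x j / (x j + ?c)) \<le> ((?c - y) / ?c) * (x j / (x j + y))"
      using xj assms cfun_pos by (intro mult_left_mono divide_left_mono mult_pos_pos) auto
    also have "\<dots> = 1 - (1 + x j / ?c) / (1 + x j / y)"
      using xj assms cfun_pos add_pos_pos[OF xj assms(1)]
      by (simp add: divide_simps) (simp add: algebra_simps)
    also have "\<dots> \<le> ln (1 + x j / y) - ln (1 + x j / ?c)"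
    proof -
      have "ln (1 + x j / ?c) - ln (1 + x j / y) \<le> (1 + x j / ?c) / (1 + x j / y) - 1"
        using assms xj cfun_pos by (intro ln_diff_le add_pos_pos) auto
      thus ?thesis by linarith
    qed
    finally show "((?c - y) / ?c) * (x j / (x j + ?c)) \<le> ln (1 + x j / y) - ln (1 + x j / ?c)" .
  qed
  finally show ?thesis .
qed

text \<open>Curvature of order \<open>1/c\<close> makes the slope at distance \<open>\<surd>c / 2\<close> from \<open>c\<close> at least
  \<open>1 / (6 \<surd>c)\<close> in absolute value, and by concavity the tangents there bound \<open>growth\<close> further
  out. Within the window the maximum \<open>F\<close> suffices.\<close>

lemma growth_decay:
  assumes c: "1 \<le> cfun k x" and "0 < t"
  shows "growth k x t \<le> Ffun k x + 1 - \<bar>t - cfun k x\<bar> / (6 * sqrt (cfun k x))"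
proof -
  define c where "c = cfun k x"
  define s where "s = sqrt c"
  have s: "1 \<le> s" "c = s * s" using c by (simp_all add: s_def c_def)
  have "s * 1 \<le> s * s" using s by (intro mult_left_mono) auto
  hence sc: "s \<le> c" using s by simp
  define D where "D = 1 / (6 * s)"
  have D: "0 < D" "D * s = 1/6" using s by (simp_all add: D_def)
  have "growth k x t \<le> Ffun k x + 1 - \<bar>t - c\<bar> * D"
  proof (cases "\<bar>t - c\<bar> \<le> s / 2")
    case True
    hence "\<bar>t - c\<bar> * D \<le> s / 2 * D" using D by (intro mult_right_mono) auto
    thus ?thesis using growth_le_Ffun[OF assms(2)] D by (simp add: mult.commute)
  next
    case False
    show ?thesis
    proof (cases "c \<le> t")
      case True
      define y where "y = c + s / 2"
      have y: "0 < y" "c \<le> y" "y \<le> t" using False True s sc c by (auto simp: y_def c_def[symmetric] simp del: s(2))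
      have "D \<le> (y - c) / (2 * y)"
      proof -
        have "y * 2 \<le> 3 * c" using sc by (simp add: y_def)
        hence "1 * (y * 2) \<le> s * s * 3" using s by simp
        thus ?thesis using s y unfolding D_def by (simp add: y_def field_simps)
      qed
      hence "slope k x y \<le> - D" using slope_right[of y] y by (simp add: c_def)
      hence "(t - y) * slope k x y \<le> (t - y) * (- D)" using y by (intro mult_left_mono) auto
      hence "growth k x t \<le> Ffun k x - (t - y) * D"
        using growth_tangent[OF assms(2) y(1)] growth_le_Ffun[OF y(1)] by linarith
      also have "(t - y) * D = \<bar>t - c\<bar> * D - D * s / 2"
        using True by (simp add: y_def algebra_simps)
      finally show ?thesis using D by simp
    next
      case ct: False
      define y where "y = c - s / 2"
      have y: "0 < y" "y \<le> c" "t \<le> y" using False ct s sc by (auto simp: y_def)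
      have "D \<le> (c - y) / (2 * c)"
        using s unfolding D_def by (simp add: y_def field_simps)
      hence "D \<le> slope k x y" using slope_left[of y] y by (simp add: c_def)
      hence "(y - t) * D \<le> (y - t) * slope k x y" using y by (intro mult_left_mono) auto
      hence "growth k x t \<le> Ffun k x - (y - t) * D"
        using growth_tangent[OF assms(2) y(1)] growth_le_Ffun[OF y(1)]
        by (simp add: algebra_simps)
      also have "(y - t) * D = \<bar>t - c\<bar> * D - D * s / 2"
        using ct by (simp add: y_def algebra_simps)
      finally show ?thesis using D by simp
    qed
  qed
  thus ?thesis by (simp add: D_def c_def s_def)
qed

text \<open>Below \<open>c\<close>, the loss is at most the slope at the left end. It is bounded because
  \<open>1 + 3u \<le> (1 + u)\<^sup>3\<close> turns \<open>\<Prod> (1 + x\<^sub>j / c) = 2\<close> into \<open>\<Prod> (1 + x\<^sub>j / t) \<le> 2\<^sup>3\<close>.\<close>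

lemma growth_near_cfun:
  assumes "cfun k x / 3 \<le> t" "t \<le> cfun k x" "cfun k x \<le> t + 1"
  shows "Ffun k x - 2 * ln 2 \<le> growth k x t"
proof -
  let ?c = "cfun k x"
  have t: "0 < t" using assms cfun_pos by simp
  have "(\<Sum>j=1..k. ln (1 + x j / t)) \<le> (\<Sum>j=1..k. 3 * ln (1 + x j / ?c))"
  proof (rule sum_mono)
    fix j assume j: "j \<in> {1..k}"
    have xj: "0 < x j" using x_pos j .
    have "x j / t \<le> x j / (?c / 3)"
      using xj assms cfun_pos t by (intro divide_left_mono) auto
    hence "1 + x j / t \<le> 1 + 3 * (x j / ?c)" by (simp add: mult.commute)
    also have "\<dots> \<le> (1 + x j / ?c) ^ 3"
      using Bernoulli_inequality[of "x j / ?c" 3] xj cfun_pos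
        divide_pos_pos[OF xj cfun_pos] by simp
    finally have "ln (1 + x j / t) \<le> ln ((1 + x j / ?c) ^ 3)"
      using xj t by (intro ln_mono) (auto intro!: add_pos_pos)
    thus "ln (1 + x j / t) \<le> 3 * ln (1 + x j / ?c)"
      by (simp add: ln_realpow one_plus_cfun_pos[OF j])
  qed
  also have "\<dots> = 3 * ln 2" using slope_cfun by (simp add: slope_def flip: sum_distrib_left)
  finally have "slope k x t \<le> 2 * ln 2" by (simp add: slope_def)
  hence "(?c - t) * slope k x t \<le> 1 * (2 * ln 2)"
    using assms slope_left[OF t assms(2)] cfun_pos
    by (intro mult_mono order_trans[OF _ slope_left[OF t assms(2)]] divide_nonneg_pos) auto
  thus ?thesis using growth_tangent[OF cfun_pos t] by (simp add: growth_cfun)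
qed

end

section \<open>Comparison with a power of n\<close>

text \<open>Gibbs' inequality at \<open>(q\<^sub>j, 1 - q\<^sub>j)\<close>, summed over \<open>j\<close>. The coefficient \<open>c\<close> of
  \<open>ln (1 - q\<^sub>j)\<close> does not depend on \<open>j\<close>, so only the product of the \<open>1 - q\<^sub>j\<close> enters, and
  it cancels the term \<open>c ln 2\<close> of \<open>growth\<close>.\<close>

lemma Ffun_le_of_prod_eq_2:
  fixes q :: "nat \<Rightarrow> real"
  assumes k: "1 \<le> k" and x: "\<And>j. j \<in> {1..k} \<Longrightarrow> 0 < x j"
    and q: "\<And>j. j \<in> {1..k} \<Longrightarrow> 0 < q j \<and> q j < 1"
    and prod: "(\<Prod>j=1..k. inverse (1 - q j)) = 2"
  shows "Ffun k x \<le> - (\<Sum>j=1..k. x j * ln (q j))"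
proof -
  let ?c = "cfun k x"
  have "ln (\<Prod>j=1..k. inverse (1 - q j)) = (\<Sum>j=1..k. ln (inverse (1 - q j)))"
    using q by (intro ln_prod) force+
  also have "\<dots> = - (\<Sum>j=1..k. ln (1 - q j))"
    using q by (subst sum_negf[symmetric], intro sum.cong refl, subst ln_inverse) auto
  finally have ln2: "(\<Sum>j=1..k. ln (1 - q j)) = - ln 2" using prod by simp
  have "(\<Sum>j=1..k. entropy (x j) ?c) \<le> (\<Sum>j=1..k. - (x j * ln (q j)) - ?c * ln (1 - q j))"
    using x q cfun_pos[OF k x] by (intro sum_mono entropy_le) auto
  also have "\<dots> = - (\<Sum>j=1..k. x j * ln (q j)) - ?c * (\<Sum>j=1..k. ln (1 - q j))"
    by (simp add: sum_subtractf sum_negf sum_distrib_left)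
  finally show ?thesis
    using growth_cfun[of k x, OF k x] ln2 by (simp add: growth_def)
qed

lemma Ffun_le_rho:
  assumes k: "1 \<le> k" and \<alpha>: "\<And>i. i \<in> {1..k} \<Longrightarrow> 1 \<le> \<alpha> i"
  shows "Ffun k (\<lambda>i. real (\<alpha> i)) \<le> rho k * ln (real (\<Prod>i=1..k. nth_prime i ^ \<alpha> i))"
proof -
  have rho: "0 < rho k" "(\<Prod>j=1..k. inverse (1 - real (nth_prime j) powr (- rho k))) = 2"
    using theI'[OF ex1_rho[OF k]] by (auto simp: rho_def)
  have p: "1 < real (nth_prime j)" for j
    using prime_gt_1_nat[OF prime_nth_prime] by simp
  have "real (nth_prime j) powr (- rho k) < 1" for j
    using powr_less_mono[of "- rho k" 0 "real (nth_prime j)"] p[of j] rho(1) by simp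
  hence "Ffun k (\<lambda>i. real (\<alpha> i)) \<le> - (\<Sum>j=1..k. real (\<alpha> j) * ln (real (nth_prime j) powr (- rho k)))"
    using less_trans[OF zero_less_one p] \<alpha> rho(2)
    by (intro Ffun_le_of_prod_eq_2[OF k]) (auto simp: less_eq_Suc_le)
  also have "\<dots> = rho k * (\<Sum>j=1..k. real (\<alpha> j) * ln (real (nth_prime j)))"
    using p by (simp add: ln_powr sum_distrib_left sum_negf mult_ac)
  also have "(\<Sum>j=1..k. real (\<alpha> j) * ln (real (nth_prime j)))
      = (\<Sum>j=1..k. ln (real (nth_prime j ^ \<alpha> j)))"
    using p by (intro sum.cong refl) (simp add: ln_realpow)
  also have "\<dots> = ln (\<Prod>j=1..k. real (nth_prime j ^ \<alpha> j))"
    using p by (intro ln_prod[symmetric]) (auto simp: prime_gt_0_nat[OF prime_nth_prime])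
  finally show ?thesis by simp
qed

section \<open>Summation of the series\<close>

text \<open>Two geometric series, one on each side of \<open>\<lfloor>c\<rfloor>\<close>.\<close>

lemma sum_exp_decay_le:
  fixes c D :: real
  assumes "0 \<le> c" "0 < D"
  shows "(\<Sum>r<N. exp (- (\<bar>real r - c\<bar> * D))) \<le> 2 * (1 + 1 / D)"
proof -
  define m where "m = nat \<lfloor>c\<rfloor>"
  have m: "real m \<le> c" "c \<le> real m + 1" using assms unfolding m_def by linarith+
  define f where "f r = exp (- (\<bar>real r - c\<bar> * D))" for r
  define q where "q = exp (- D)"
  have q: "0 < q" "q < 1" using assms by (simp_all add: q_def)
  have f_le: "f r \<le> q ^ i" if "real i \<le> \<bar>real r - c\<bar>" for r i
  proof -
    have "real i * D \<le> \<bar>real r - c\<bar> * D" using that assms by (intro mult_right_mono) auto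
    thus ?thesis by (simp add: f_def q_def flip: exp_of_nat_mult)
  qed
  have geom: "(\<Sum>i<M. q ^ i) \<le> 1 + 1 / D" for M
  proof -
    have "(\<Sum>i<M. q ^ i) = (1 - q ^ M) / (1 - q)"
      using q by (simp add: sum_gp_strict)
    also have "\<dots> \<le> 1 / (1 - q)" using q by (intro divide_right_mono) auto
    also have "\<dots> \<le> 1 + 1 / D"
    proof -
      have "(1 + D) * q \<le> exp D * q" using q by (intro mult_right_mono exp_ge_add_one_self) auto
      also have "\<dots> = 1" by (simp add: q_def flip: exp_add)
      finally show ?thesis using q assms by (simp add: field_simps)
    qed
    finally show ?thesis .
  qed
  have split: "(\<Sum>r<a + b. f r) = (\<Sum>r<a. f r) + (\<Sum>i<b. f (a + i))" for a b
    by (induction b) (simp_all add: add.assoc)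
  have "(\<Sum>r<N. f r) \<le> (\<Sum>r<Suc m + N. f r)"
    by (intro sum_mono2) (auto simp: f_def)
  also have "\<dots> = (\<Sum>r<Suc m. f r) + (\<Sum>i<N. f (Suc m + i))" by (rule split)
  also have "(\<Sum>r<Suc m. f r) = (\<Sum>i<Suc m. f (m - i))"
    by (subst sum.nat_diff_reindex[symmetric]) simp
  also have "\<dots> \<le> (\<Sum>i<Suc m. q ^ i)"
    using m by (intro sum_mono f_le) (auto simp: of_nat_diff)
  also have "\<dots> \<le> 1 + 1 / D" by (rule geom)
  also have "(\<Sum>i<N. f (Suc m + i)) \<le> (\<Sum>i<N. q ^ i)"
    using m by (intro sum_mono f_le) auto
  also have "\<dots> \<le> 1 + 1 / D" by (rule geom)
  finally show ?thesis by (simp add: f_def)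
qed

lemma sqrt_prod: "sqrt (\<Prod>i\<in>A. f i) = (\<Prod>i\<in>A. sqrt (f i))"
  by (induction A rule: infinite_finite_induct) (simp_all add: real_sqrt_mult)

text \<open>The decay rate has to be uniform in \<open>r\<close>, so that the sum over \<open>r\<close> is geometric. The term
  \<open>r = 0\<close>, where \<open>entropy\<close> degenerates, vanishes.\<close>

lemma multichoose_prod_upper:
  assumes k: "1 \<le> k" and \<alpha>: "\<And>i. i \<in> {1..k} \<Longrightarrow> 1 \<le> \<alpha> i"
  shows "(\<Prod>i=1..k. multichoose r (\<alpha> i)) / 2 ^ Suc r
    \<le> exp (Ffun k (\<lambda>i. real (\<alpha> i)) + 1)
        * exp (- (\<bar>real r - cfun k (\<lambda>i. real (\<alpha> i))\<bar> / (6 * sqrt (cfun k (\<lambda>i. real (\<alpha> i))))))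
        / (2 * (2 ^ k * sqrt (\<Prod>i=1..k. real (\<alpha> i))))"
proof (cases "r = 0")
  case True
  have "multichoose 0 (\<alpha> 1) = 0"
    using \<alpha>[of 1] k by (simp add: multichoose_def pochhammer_0_left)
  hence zero: "(\<Prod>i=1..k. multichoose r (\<alpha> i)) = 0"
    using True k by (intro prod_zero bexI[of _ 1]) auto
  have "0 \<le> (\<Prod>i=1..k. real (\<alpha> i))" by (intro prod_nonneg) auto
  thus ?thesis unfolding zero by simp
next
  case False
  let ?x = "\<lambda>i. real (\<alpha> i)"
  have x: "0 < ?x j" if "j \<in> {1..k}" for j using \<alpha>[OF that] by simp
  have c: "1 \<le> cfun k ?x" using cfun_ge_first[of k ?x, OF k x] \<alpha>[of 1] k by fastforce
  have "(\<Prod>i=1..k. multichoose r (\<alpha> i)) \<le> (\<Prod>i=1..k. exp (entropy (\<alpha> i) r) / (2 * sqrt (\<alpha> i)))"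
    using False \<alpha> by (intro prod_mono conjI multichoose_nonneg multichoose_upper) auto
  also have "\<dots> = exp (\<Sum>i=1..k. entropy (\<alpha> i) r) / (2 ^ k * sqrt (\<Prod>i=1..k. ?x i))"
    by (simp add: prod_dividef prod.distrib exp_sum sqrt_prod)
  finally have "(\<Prod>i=1..k. multichoose r (\<alpha> i)) / 2 ^ Suc r
      \<le> exp (\<Sum>i=1..k. entropy (\<alpha> i) r) / (2 ^ k * sqrt (\<Prod>i=1..k. ?x i)) / 2 ^ Suc r"
    by (intro divide_right_mono) auto
  also have "\<dots> = exp (growth k ?x r) / (2 * (2 ^ k * sqrt (\<Prod>i=1..k. ?x i)))"
  proof -
    have "exp (real r * ln 2) = (2::real) ^ r" by (simp add: exp_of_nat_mult)
    thus ?thesis by (simp add: growth_def exp_diff)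
  qed
  also have "\<dots> \<le> exp (Ffun k ?x + 1 - \<bar>real r - cfun k ?x\<bar> / (6 * sqrt (cfun k ?x)))
      / (2 * (2 ^ k * sqrt (\<Prod>i=1..k. ?x i)))"
    using growth_decay[of k ?x, OF k x c, of r] False
    by (intro divide_right_mono) (auto intro!: mult_nonneg_nonneg prod_nonneg)
  finally show ?thesis by (simp only: exp_add[symmetric] diff_conv_add_uminus)
qed

lemma sum_le_mult_prod:
  fixes \<alpha> :: "nat \<Rightarrow> nat"
  assumes "\<And>i. i \<in> {1..k} \<Longrightarrow> 1 \<le> \<alpha> i"
  shows "(\<Sum>i=1..k. real (\<alpha> i)) \<le> real k * (\<Prod>i=1..k. real (\<alpha> i))"
proof -
  have "real (\<alpha> i) \<le> (\<Prod>i=1..k. real (\<alpha> i))" if "i \<in> {1..k}" for i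
  proof -
    have "1 \<le> (\<Prod>i\<in>{1..k} - {i}. real (\<alpha> i))"
      using assms by (intro prod_ge_1) auto
    hence "real (\<alpha> i) * 1 \<le> real (\<alpha> i) * (\<Prod>i\<in>{1..k} - {i}. real (\<alpha> i))"
      by (intro mult_left_mono) auto
    thus ?thesis using that by (subst prod.remove[of _ i]) auto
  qed
  hence "(\<Sum>i=1..k. real (\<alpha> i)) \<le> (\<Sum>i=1..k. \<Prod>i=1..k. real (\<alpha> i))" by (intro sum_mono)
  thus ?thesis by simp
qed

text \<open>Bernoulli's inequality for \<open>(4 / \<pi>)\<^sup>k\<close>. This absorbs the factor \<open>\<surd>k\<close>, at the price of \<open>\<pi>\<close> in
  place of \<open>4\<close>.\<close>

lemma sqrt_le_pi_power:
  "sqrt (2 * real k) / 2 ^ k \<le> sqrt (2 / (4 / pi - 1)) / pi powr (real k / 2)"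
proof -
  have gap: "0 < 4 / pi - 1" using pi_less_4 pi_gt_zero by simp
  have "1 + real k * (4 / pi - 1) \<le> (1 + (4 / pi - 1)) ^ k"
    using gap by (intro Bernoulli_inequality) auto
  hence "real k * (4 / pi - 1) \<le> (4 / pi) ^ k" by simp
  hence "2 * real k / 4 ^ k \<le> 2 / (4 / pi - 1) / pi ^ k"
    using gap by (simp add: power_divide pos_le_divide_eq field_simps)
  hence "sqrt (2 * real k / 4 ^ k) \<le> sqrt (2 / (4 / pi - 1) / pi ^ k)" by simp
  moreover have "sqrt (4 ^ k) = (2::real) ^ k" by (simp add: real_sqrt_power)
  moreover have "sqrt (pi ^ k) = pi powr (real k / 2)"
    by (simp add: powr_powr flip: powr_half_sqrt powr_realpow)
  ultimately show ?thesis by (simp only: real_sqrt_divide)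
qed

section \<open>The bounds for the Kalmar function\<close>

lemma kalmar_upper:
  assumes k: "1 \<le> k" and \<alpha>: "\<And>i. i \<in> {1..k} \<Longrightarrow> 1 \<le> \<alpha> i"
  shows "real (kalmar (\<Prod>i=1..k. nth_prime i ^ \<alpha> i))
    \<le> 7 * exp 1 * sqrt (2 / (4 / pi - 1)) * (exp (Ffun k (\<lambda>i. real (\<alpha> i))) / pi powr (real k / 2))"
proof -
  let ?x = "\<lambda>i. real (\<alpha> i)"
  define n where "n = (\<Prod>i=1..k. nth_prime i ^ \<alpha> i)"
  define c where "c = cfun k ?x"
  define P where "P = (\<Prod>i=1..k. ?x i)"
  define E where "E = exp (Ffun k ?x + 1)"
  have x: "0 < ?x j" if "j \<in> {1..k}" for j using \<alpha>[OF that] by simp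
  have P: "0 < P" unfolding P_def using x by (intro prod_pos) auto
  have c: "1 \<le> c" unfolding c_def using cfun_ge_first[of k ?x, OF k x] \<alpha>[of 1] k by fastforce
  have n: "0 < n" unfolding n_def using prime_gt_0_nat[OF prime_nth_prime] by (intro prod_pos) auto
  have "(\<Sum>r<N. tuple_count r n / 2 ^ Suc r) \<le> 7 * E * sqrt c / (2 ^ k * sqrt P)" for N
  proof -
    have "(\<Sum>r<N. tuple_count r n / 2 ^ Suc r)
        \<le> (\<Sum>r<N. E * exp (- (\<bar>real r - c\<bar> * (1 / (6 * sqrt c)))) / (2 * (2 ^ k * sqrt P)))"
      unfolding n_def tuple_count_prod_primes
      using multichoose_prod_upper[OF k \<alpha>] by (intro sum_mono) (simp add: E_def c_def P_def)
    also have "\<dots> = E * (\<Sum>r<N. exp (- (\<bar>real r - c\<bar> * (1 / (6 * sqrt c))))) / (2 * (2 ^ k * sqrt P))"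
      by (simp add: sum_distrib_left sum_divide_distrib)
    also have "\<dots> \<le> E * (2 * (1 + 1 / (1 / (6 * sqrt c)))) / (2 * (2 ^ k * sqrt P))"
      using c P by (intro divide_right_mono mult_left_mono sum_exp_decay_le) (auto simp: E_def)
    \<comment> \<open>\<open>2 (1 + 6 \<surd>c) \<le> 14 \<surd>c\<close>, since \<open>c \<ge> 1\<close>\<close>
    also have "\<dots> \<le> E * (14 * sqrt c) / (2 * (2 ^ k * sqrt P))"
      using c P by (intro divide_right_mono mult_left_mono) (auto simp: E_def)
    also have "\<dots> = 7 * E * sqrt c / (2 ^ k * sqrt P)" by (simp add: field_simps)
    finally show ?thesis .
  qed
  hence "real (kalmar n) \<le> 7 * E * sqrt c / (2 ^ k * sqrt P)"
    using kalmar_sums[OF n] unfolding sums_def by (intro LIMSEQ_le_const2) auto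
  also have "\<dots> \<le> 7 * E * (sqrt (2 * real k) * sqrt P) / (2 ^ k * sqrt P)"
  proof -
    have "c \<le> 2 * real k * P"
      using cfun_le_sum[of k ?x, OF k x] sum_le_mult_prod[of k \<alpha>, OF \<alpha>] by (simp add: c_def P_def mult.assoc)
    hence "sqrt c \<le> sqrt (2 * real k) * sqrt P" by (simp flip: real_sqrt_mult)
    thus ?thesis using P by (intro divide_right_mono mult_left_mono) (auto simp: E_def)
  qed
  also have "\<dots> = 7 * E * (sqrt (2 * real k) / 2 ^ k)" using P by simp
  also have "\<dots> \<le> 7 * E * (sqrt (2 / (4 / pi - 1)) / pi powr (real k / 2))"
    using sqrt_le_pi_power by (intro mult_left_mono) (auto simp: E_def)
  finally show ?thesis by (simp add: n_def E_def exp_add mult_ac)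
qed

lemma kalmar_lower:
  assumes k: "1 \<le> k" and \<alpha>: "\<And>i. i \<in> {1..k} \<Longrightarrow> 1 \<le> \<alpha> i"
  shows "exp (- (7 / 2 * ln 2)) * (exp (Ffun k (\<lambda>i. real (\<alpha> i))) / (exp 1 ^ k * sqrt (\<Prod>i=1..k. real (\<alpha> i))))
    \<le> real (kalmar (\<Prod>i=1..k. nth_prime i ^ \<alpha> i))"
proof -
  let ?x = "\<lambda>i. real (\<alpha> i)"
  define n where "n = (\<Prod>i=1..k. nth_prime i ^ \<alpha> i)"
  define c where "c = cfun k ?x"
  define P where "P = (\<Prod>i=1..k. ?x i)"
  define r where "r = nat \<lfloor>c + 1/2\<rfloor>"
  \<comment> \<open>The choice of \<open>r\<close> puts \<open>t\<close> into \<open>(c - 1, c]\<close>. The exponent \<open>7/2\<close> in the constant is 2 from the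
    distance to the maximum and \<open>3/2\<close> from \<open>r + 1 = t + 3/2\<close>.\<close>
  define t where "t = real r - 1/2"
  have x: "0 < ?x j" if "j \<in> {1..k}" for j using \<alpha>[OF that] by simp
  have P: "0 < P" unfolding P_def using x by (intro prod_pos) auto
  have c: "1 \<le> c" unfolding c_def using cfun_ge_first[of k ?x, OF k x] \<alpha>[of 1] k by fastforce
  have n: "0 < n" unfolding n_def using prime_gt_0_nat[OF prime_nth_prime] by (intro prod_pos) auto
  have r: "1 \<le> r" using c unfolding r_def by linarith
  have t: "t \<le> c" "c \<le> t + 1" using c unfolding r_def t_def by linarith+
  have "c / 3 \<le> t" using t r unfolding t_def by linarith
  hence "Ffun k ?x - 2 * ln 2 \<le> growth k ?x t"
    using t unfolding c_def by (intro growth_near_cfun[of k ?x, OF k x]) auto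
  hence "exp (- (7 / 2 * ln 2)) * (exp (Ffun k ?x) / (exp 1 ^ k * sqrt P))
      \<le> exp (growth k ?x t - 3 / 2 * ln 2) / (exp 1 ^ k * sqrt P)"
    using P unfolding times_divide_eq_right exp_add[symmetric] by (intro divide_right_mono) auto
  also have "growth k ?x t - 3 / 2 * ln 2 = (\<Sum>i=1..k. entropy (\<alpha> i) t) - real (Suc r) * ln 2"
    by (simp add: growth_def t_def algebra_simps)
  also have "exp \<dots> / (exp 1 ^ k * sqrt P)
      = (\<Prod>i=1..k. exp (entropy (\<alpha> i) t) / (exp 1 * sqrt (\<alpha> i))) / 2 ^ Suc r"
  proof -
    have "exp (real (Suc r) * ln 2) = (2::real) ^ Suc r" by (subst exp_of_nat_mult) simp
    thus ?thesis by (simp add: P_def prod_dividef prod.distrib exp_sum exp_diff sqrt_prod)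
  qed
  also have "\<dots> \<le> (\<Prod>i=1..k. multichoose r (\<alpha> i)) / 2 ^ Suc r"
    using r \<alpha> unfolding t_def
    by (intro divide_right_mono prod_mono conjI multichoose_lower) auto
  also have "\<dots> = tuple_count r n / 2 ^ Suc r"
    unfolding n_def by (simp only: tuple_count_prod_primes)
  also have "\<dots> \<le> real (kalmar n)"
    using sum_le_suminf[of "\<lambda>r. tuple_count r n / 2 ^ Suc r" "{r}"] kalmar_sums[OF n] tuple_count_nonneg
    by (simp add: sums_iff)
  finally show ?thesis by (simp add: n_def P_def)
qed

theorem mainTheorem6:
  shows "\<exists>C\<^sub>3 C\<^sub>4 :: real. 0 < C\<^sub>3 \<and> 0 < C\<^sub>4 \<and>
    (\<forall>(n::nat) (k::nat) (\<alpha> :: nat \<Rightarrow> nat).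
       2 \<le> n \<longrightarrow> (\<forall>i\<in>{1..k}. 1 \<le> \<alpha> i) \<longrightarrow> n = (\<Prod>i=1..k. nth_prime i ^ \<alpha> i) \<longrightarrow>
         C\<^sub>3 * (exp (Ffun k (\<lambda>i. real (\<alpha> i))) / (exp 1 ^ k * sqrt (\<Prod>i=1..k. real (\<alpha> i))))
           \<le> real (kalmar n) \<and>
         real (kalmar n) \<le> C\<^sub>4 * (exp (Ffun k (\<lambda>i. real (\<alpha> i))) / pi powr (real k / 2)) \<and>
         C\<^sub>4 * (exp (Ffun k (\<lambda>i. real (\<alpha> i))) / pi powr (real k / 2))
           \<le> C\<^sub>4 * (exp (rho k * ln (real n)) / pi powr (real k / 2)))"
proof -
  define C\<^sub>3 :: real where "C\<^sub>3 = exp (- (7 / 2 * ln 2))"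
  define C\<^sub>4 :: real where "C\<^sub>4 = 7 * exp 1 * sqrt (2 / (4 / pi - 1))"
  have "0 < C\<^sub>3" by (simp add: C\<^sub>3_def)
  moreover have C4: "0 < C\<^sub>4" using pi_less_4 pi_gt_zero by (simp add: C\<^sub>4_def)
  moreover have "C\<^sub>3 * (exp (Ffun k (\<lambda>i. real (\<alpha> i))) / (exp 1 ^ k * sqrt (\<Prod>i=1..k. real (\<alpha> i))))
           \<le> real (kalmar n) \<and>
         real (kalmar n) \<le> C\<^sub>4 * (exp (Ffun k (\<lambda>i. real (\<alpha> i))) / pi powr (real k / 2)) \<and>
         C\<^sub>4 * (exp (Ffun k (\<lambda>i. real (\<alpha> i))) / pi powr (real k / 2))
           \<le> C\<^sub>4 * (exp (rho k * ln (real n)) / pi powr (real k / 2))"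
    if "2 \<le> n" and \<alpha>: "\<forall>i\<in>{1..k}. 1 \<le> \<alpha> i" and n: "n = (\<Prod>i=1..k. nth_prime i ^ \<alpha> i)"
    for n k and \<alpha> :: "nat \<Rightarrow> nat"
  proof -
    have k: "1 \<le> k" using that by (cases "k = 0") auto
    have "exp (Ffun k (\<lambda>i. real (\<alpha> i))) \<le> exp (rho k * ln (real n))"
      unfolding n exp_le_cancel_iff using \<alpha> by (intro Ffun_le_rho[OF k]) blast
    hence "C\<^sub>4 * (exp (Ffun k (\<lambda>i. real (\<alpha> i))) / pi powr (real k / 2))
        \<le> C\<^sub>4 * (exp (rho k * ln (real n)) / pi powr (real k / 2))"
      using C4 by (intro mult_left_mono divide_right_mono) auto
    thus ?thesis
      using kalmar_lower[OF k] kalmar_upper[OF k] \<alpha> unfolding n C\<^sub>3_def C\<^sub>4_def by blast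
  qed
  ultimately show ?thesis by blast
qed

end
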